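(* Let $A$ be a countable periodic abelian group (written additively), and let $\Phi$ be a group of FC-automorphisms of $A$ such that $\mathrm{cf}(|\Phi|)>\omega$. Then there is a subgroup $B\le A$ such that $|\{B\varphi:\varphi\in\Phi\}|=|\Phi|$.
   Context: For an FC-group $G$, an automorphism $\varphi$ of $G$ is an FC-automorphism if the set $\{g\,(g^{-1})\varphi: g\in G\}$ is finite; for abelian $A$ written additively this means $\{a-a\varphi: a\in A\}$ is finite. $B\varphi$ denotes the image of $B$ under $\varphi$, and $\mathrm{cf}$ denotes cofinality. *)

theory Defs
  imports "HOL-Algebra.Algebra" "HOL-Library.Countable_Set"
begin

unbundle cardinal_syntax

definition periodic :: "('a, 'b) monoid_scheme \<Rightarrow> bool" where
  "periodic G \<longleftrightarrow> (\<forall>x\<in>carrier G. \<exists>n::nat. 0 < n \<and> x [^]\<^bsub>G\<^esub> n = \<one>\<^bsub>G\<^esub>)"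

(* Elements of auto G are extensional, so distinct functions are distinct automorphisms and
   cardinalities of sets of automorphisms come out right. *)
definition fc_automorphism :: "('a, 'b) monoid_scheme \<Rightarrow> ('a \<Rightarrow> 'a) \<Rightarrow> bool" where
  "fc_automorphism G \<phi> \<longleftrightarrow>
     \<phi> \<in> auto G \<and> finite {g \<otimes>\<^bsub>G\<^esub> \<phi> (inv\<^bsub>G\<^esub> g) | g. g \<in> carrier G}"

(* The library's strict notion cofinal is not used: no subset of a nonempty finite well-order
   is strictly cofinal. With the non-strict notion a nonzero finite cardinal has cofinality 1;
   for infinite cardinals the two notions agree. *)
definition cofinal_subset :: "'a set \<Rightarrow> 'a rel \<Rightarrow> bool" where
  "cofinal_subset K r \<longleftrightarrow> K \<subseteq> Field r \<and> (\<forall>a\<in>Field r. \<exists>b\<in>K. (a, b) \<in> r)"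

(* The least cardinality of a cofinal subset, determined up to order isomorphism. *)
definition cofinality :: "'a rel \<Rightarrow> 'a rel" where
  "cofinality r = (SOME c. (\<exists>K. cofinal_subset K r \<and> c = |K| ) \<and>
                           (\<forall>K. cofinal_subset K r \<longrightarrow> c \<le>o |K| ))"

lemma cofinality_props:
  fixes r :: "'a rel"
  assumes "Card_order r"
  shows "\<exists>K. cofinal_subset K r \<and> cofinality r = |K|"
    and "cofinal_subset K r \<Longrightarrow> cofinality r \<le>o |K|"
proof -
  have "refl_on (Field r) r"
    using assms unfolding card_order_on_def well_order_on_def linear_order_on_def
      partial_order_on_def preorder_on_def by blast
  hence "cofinal_subset (Field r) r"
    unfolding cofinal_subset_def refl_on_def by blast
  hence "\<exists>c\<in>{|K| | K. cofinal_subset K r}. \<forall>c'\<in>{|K| | K. cofinal_subset K r}. c \<le>o c'"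
    by (intro exists_minim_Card_order) (auto simp: card_of_Card_order)
  hence "\<exists>c. (\<exists>K. cofinal_subset K r \<and> c = |K| ) \<and> (\<forall>K. cofinal_subset K r \<longrightarrow> c \<le>o |K| )"
    by blast
  from someI_ex[OF this, folded cofinality_def]
  show "\<exists>K. cofinal_subset K r \<and> cofinality r = |K|"
    and "cofinal_subset K r \<Longrightarrow> cofinality r \<le>o |K|" by blast+
qed

lemma natLeq_less_cofinality_iff:
  assumes "Card_order r"
  shows "natLeq <o cofinality r \<longleftrightarrow> (\<forall>K. cofinal_subset K r \<longrightarrow> natLeq <o |K| )"
  using cofinality_props[OF assms] ordLess_ordLeq_trans by metis

end

theory Submission
  imports Defs
begin

text \<open>The displacements \<open>g \<phi>(g\<inverse>)\<close> of an FC-automorphism \<open>\<phi>\<close> form a finite subgroup of the countable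
  group \<open>A\<close>, so the cofinality hypothesis gives \<open>|\<Phi>|\<close> many \<open>\<phi>\<close> with the same displacement
  subgroup \<open>F\<close>, of order \<open>e\<close> say. Choose a subgroup \<open>B\<close> maximal with \<open>B \<inter> F = 1\<close>.
  Since \<open>b\<close> and \<open>\<phi>(b)\<close> differ by an element of \<open>F\<close>, the image of \<open>B\<close> under such a \<open>\<phi>\<close> determines
  the restriction of \<open>\<phi>\<close> to \<open>B\<close>; moreover \<open>\<phi>\<close> fixes all \<open>e\<close>-th powers. By maximality \<open>A / B\<close> is
  an essential extension of a finite group, so its \<open>e\<close>-torsion is finite, and therefore
  \<open>A / B A\<^sup>e\<close> is finite. Hence \<open>\<phi>\<close> is determined by the image of \<open>B\<close> together with its values on a
  finite set, for which there are only countably many possibilities, while \<open>|\<Phi>|\<close> is uncountable.\<close>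

section \<open>Cardinal arithmetic: uncountable cofinality and countable partitions\<close>

lemma countable_iff_card_of_ordLeq_nat: "countable S \<longleftrightarrow> |S| \<le>o |UNIV :: nat set|"
  unfolding countable_def by (simp flip: card_of_ordLeq)

text \<open>The whole set is cofinal in its own cardinal order, so the cofinality is at most
  \<open>|S|\<close>.\<close>

lemma uncountable_if_natLeq_less_cofinality:
  assumes "natLeq <o cofinality |S|"
  shows "uncountable S"
proof -
  have "cofinal_subset S |S|"
    using card_of_well_order_on[of S]
    unfolding cofinal_subset_def well_order_on_def linear_order_on_def partial_order_on_def
      preorder_on_def refl_on_def by (auto simp: Field_card_of)
  then have "natLeq <o |S|"
    using assms natLeq_less_cofinality_iff[OF card_of_Card_order] by blast
  moreover have "|S| \<le>o natLeq" if "countable S"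
    using that countable_iff_card_of_ordLeq_nat card_of_nat ordLeq_ordIso_trans by blast
  ultimately show ?thesis
    using not_ordLess_ordLeq by blast
qed

text \<open>A countable set is too small to be cofinal, so some \<open>a\<close> lies below no
  member of \<open>K\<close>; as the order is total, \<open>a\<close> is then strictly above all of
  them.\<close>

lemma bounded_if_natLeq_less_cofinality:
  assumes cf: "natLeq <o cofinality |S|" and "countable K" and "K \<subseteq> S"
  obtains a where "a \<in> S" and "K \<subseteq> underS (card_of S) a"
proof -
  have "|K| \<le>o natLeq"
    using \<open>countable K\<close> countable_iff_card_of_ordLeq_nat card_of_nat ordLeq_ordIso_trans by blast
  then have "\<not> cofinal_subset K |S|"
    using cf natLeq_less_cofinality_iff[OF card_of_Card_order] not_ordLess_ordLeq by blast
  then obtain a where a: "a \<in> S" and *: "\<And>b. b \<in> K \<Longrightarrow> (a, b) \<notin> |S|"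
    using \<open>K \<subseteq> S\<close> unfolding cofinal_subset_def Field_card_of by blast
  have "K \<subseteq> underS (card_of S) a"
  proof
    fix b assume b: "b \<in> K"
    have tot: "total_on S |S|" and refl: "refl_on S |S|"
      using card_of_well_order_on[of S]
      unfolding well_order_on_def linear_order_on_def partial_order_on_def preorder_on_def
      by blast+
    have "b \<noteq> a"
      using *[OF b] refl_onD[OF refl a] by metis
    moreover from this have "(b, a) \<in> |S|"
      using tot a *[OF b] b \<open>K \<subseteq> S\<close> unfolding total_on_def by (metis subsetD)
    ultimately show "b \<in> underS (card_of S) a"
      by (rule underS_I)
  qed
  with a show thesis
    by (rule that)
qed

text \<open>If every fibre were smaller than \<open>S\<close>, each would be order isomorphic to a
  proper initial segment of the cardinal order on \<open>S\<close>. The countably many end points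
  have a common bound \<open>a\<close>, so all fibres embed into the segment below \<open>a\<close>,
  and so few sets of that size cannot cover \<open>S\<close>.\<close>

lemma pigeonhole_natLeq_less_cofinality:
  assumes cf: "natLeq <o cofinality |S|" and cnt: "countable (f ` S)"
  obtains c where "c \<in> f ` S" and "|{x \<in> S. f x = c}| =o |S|"
proof (rule ccontr)
  assume "\<not> thesis"
  then have no: "\<not> |{x \<in> S. f x = c}| =o |S|" if "c \<in> f ` S" for c
    using that \<open>\<And>c. \<lbrakk>c \<in> f ` S; |{x \<in> S. f x = c}| =o |S|\<rbrakk> \<Longrightarrow> thesis\<close> by blast
  have unc: "uncountable S"
    using cf by (rule uncountable_if_natLeq_less_cofinality)
  let ?A = "\<lambda>c. {x \<in> S. f x = c}"
  have less: "|?A c| <o |S|" if "c \<in> f ` S" for c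
  proof -
    have "|?A c| \<le>o |S|" by (rule card_of_mono1) blast
    then show ?thesis
      using no[OF that] ordLeq_iff_ordLess_or_ordIso by blast
  qed
  have "\<exists>k\<in>S. |?A c| =o Restr (card_of S) (underS (card_of S) k)" if "c \<in> f ` S" for c
    using less[OF that] ordLess_iff_ordIso_Restr[OF card_of_Well_order card_of_Well_order]
    unfolding Field_card_of by blast
  then obtain k where k: "\<And>c. c \<in> f ` S \<Longrightarrow> k c \<in> S"
    and iso: "\<And>c. c \<in> f ` S \<Longrightarrow> |?A c| =o Restr (card_of S) (underS (card_of S) (k c))"
    using bchoice[of "f ` S" "\<lambda>c k. k \<in> S \<and> |?A c| =o Restr (card_of S) (underS (card_of S) k)"]
    by blast
  obtain a where a: "a \<in> S" and bd: "k ` f ` S \<subseteq> underS (card_of S) a"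
  proof (rule bounded_if_natLeq_less_cofinality[OF cf])
    show "countable (k ` f ` S)" "k ` f ` S \<subseteq> S"
      using cnt k by blast+
  qed
  have le: "|?A c| \<le>o |underS (card_of S) a|" if "c \<in> f ` S" for c
  proof -
    have "|?A c| =o card_of (Field (Restr (card_of S) (underS (card_of S) (k c))))"
      using card_of_cong[OF iso[OF that]] by (simp add: Field_card_of)
    moreover have "Field (Restr (card_of S) (underS (card_of S) (k c))) \<subseteq> underS (card_of S) (k c)"
      by (rule Field_Restr_subset)
    moreover have "underS (card_of S) (k c) \<subseteq> underS (card_of S) a"
    proof (rule underS_incr)
      show "trans |S|" "antisym |S|"
        using card_of_well_order_on[of S]
        unfolding well_order_on_def linear_order_on_def partial_order_on_def preorder_on_def
        by blast+
      show "(k c, a) \<in> |S|"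
        using bd that unfolding underS_def by blast
    qed
    ultimately show ?thesis
      by (meson card_of_mono1 ordIso_ordLeq_trans subset_trans)
  qed
  have S: "(\<Union>c\<in>f ` S. ?A c) = S" by blast
  show False
  \<comment> \<open>The cardinal bound for the union requires an infinite segment; with a finite
    one, \<open>S\<close> is a countable union of finite sets.\<close>
  proof (cases "finite (underS (card_of S) a)")
    case True
    then have "countable (?A c)" if "c \<in> f ` S" for c
      using le[OF that] card_of_ordLeq_finite countable_finite by blast
    then have "countable (\<Union>c\<in>f ` S. ?A c)"
      using cnt by blast
    then show False
      using unc unfolding S by simp
  next
    case False
    have "|f ` S| \<le>o |underS (card_of S) a|"
      using cnt False countable_iff_card_of_ordLeq_nat infinite_iff_card_of_nat ordLeq_transitive by blast
    then have "|\<Union>c\<in>f ` S. ?A c| \<le>o |underS (card_of S) a|"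
      using False le by (intro card_of_UNION_ordLeq_infinite) auto
    then have "|S| \<le>o |underS (card_of S) a|"
      unfolding S .
    moreover have "|underS (card_of S) a| <o |S|"
      using a by (intro card_of_underS) (auto simp: Field_card_of card_of_Card_order)
    ultimately show False
      using not_ordLess_ordLeq by blast
  qed
qed

text \<open>The factor \<open>P\<close> cannot be countable, since \<open>S\<close> would be too;
  being infinite, it absorbs the countable factor \<open>Q\<close>.\<close>

lemma card_of_ordLeq_if_ordLeq_Times_countable:
  assumes "uncountable S" and "countable Q" and "|S| \<le>o |P \<times> Q|"
  shows "|S| \<le>o |P|"
proof -
  have "uncountable P"
  proof
    assume "countable P"
    then have "countable (P \<times> Q)"
      using \<open>countable Q\<close> by blast
    then have "countable S"
      using \<open>|S| \<le>o |P \<times> Q|\<close> by (metis card_of_ordLeq countable_image_inj_on countable_subset image_subset_iff_funcset)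
    then show False
      using assms(1) by blast
  qed
  then have inf: "infinite P"
    by (rule uncountable_infinite)
  have "|Q| \<le>o |P|"
    using \<open>countable Q\<close> inf countable_iff_card_of_ordLeq_nat infinite_iff_card_of_nat ordLeq_transitive
    by blast
  moreover have "|P| \<le>o |P|"
    by (rule ordLeq_reflexive) (rule card_of_Well_order)
  ultimately have "|P \<times> Q| \<le>o |P|"
    using inf card_of_Times_ordLeq_infinite_Field[of "|P|" P Q]
    by (simp add: Field_card_of card_of_Card_order)
  then show ?thesis
    using assms(3) ordLeq_transitive by blast
qed

section \<open>Torsion and \<open>e\<close>-th powers in periodic abelian groups\<close>

lemma mem_set_multI: "\<lbrakk>h \<in> H; k \<in> K\<rbrakk> \<Longrightarrow> h \<otimes>\<^bsub>G\<^esub> k \<in> H <#>\<^bsub>G\<^esub> K"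
  unfolding set_mult_def by blast

context comm_group
begin

text \<open>Generators are added one at a time: each generates a finite cyclic group by periodicity,
  and in an abelian group the product of two finite subgroups is a finite subgroup.\<close>

lemma ex_finite_subgroup:
  assumes per: "periodic G" and "finite S" and "S \<subseteq> carrier G"
  shows "\<exists>H. subgroup H G \<and> finite H \<and> S \<subseteq> H"
  using assms(2,3)
proof (induction S rule: finite_induct)
  case empty
  then show ?case
    using triv_subgroup by blast
next
  case (insert s S)
  then obtain H where H: "subgroup H G" "finite H" "S \<subseteq> H" and s: "s \<in> carrier G"
    by auto
  let ?C = "carrier (subgroup_generated G {s})"
  have fin: "finite ?C"
    using per s finite_cyclic_subgroup[OF s] unfolding periodic_def by (metis gr_implies_not0)
  have C: "subgroup ?C G"
    by (rule subgroup_subgroup_generated)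
  have sC: "s \<in> ?C"
    using s by (simp add: carrier_subgroup_generated generate.incl)
  have "finite (H <#> ?C)"
    using H(2) fin unfolding set_mult_def by blast
  moreover have "x \<in> H <#> ?C" if "x \<in> S" for x
  proof -
    have "x \<in> H"
      using H(3) that by blast
    then show ?thesis
      using mem_set_multI[of x H "\<one>" ?C G] subgroup.one_closed[OF C]
        subgroup.mem_carrier[OF H(1)] by simp
  qed
  moreover have "s \<in> H <#> ?C"
    using mem_set_multI[OF subgroup.one_closed[OF H(1)] sC, of G] s by simp
  ultimately show ?case
    using mult_subgroups[OF H(1) C] by (intro exI[of _ "H <#> ?C"]) auto
qed

text \<open>Write \<open>e = p * d\<close> with \<open>p\<close> prime. The \<open>p\<close>-th
  power map sends the \<open>e\<close>-torsion into the \<open>d\<close>-torsion, which is finite by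
  induction, and each of its fibres is empty or a translate of the finite
  \<open>p\<close>-torsion.\<close>

lemma finite_torsion:
  assumes prime: "\<And>p::nat. Factorial_Ring.prime p \<Longrightarrow> finite {x \<in> carrier G. x [^] p = \<one>}" and "0 < e"
  shows "finite {x \<in> carrier G. x [^] (e::nat) = \<one>}"
  using \<open>0 < e\<close>
proof (induction e rule: less_induct)
  case (less e)
  show ?case
  proof (cases "e = 1")
    case True
    then have "{x \<in> carrier G. x [^] e = \<one>} \<subseteq> {\<one>}" by auto
    then show ?thesis by (rule finite_subset) simp
  next
    case False
    then obtain p where p: "Factorial_Ring.prime p" "p dvd e"
      using prime_factor_nat by blast
    then obtain d where d: "e = p * d" by blast
    with less.prems prime_gt_1_nat[OF p(1)] have "0 < d" "d < e" by auto
    with less.IH have fin: "finite {x \<in> carrier G. x [^] d = \<one>}" by blast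
    have fibre: "finite {x \<in> carrier G. x [^] p = c}" for c
    proof (cases "\<exists>r\<in>carrier G. r [^] p = c")
      case True
      then obtain r where r: "r \<in> carrier G" "r [^] p = c" by blast
      have "{x \<in> carrier G. x [^] p = c} \<subseteq> (\<lambda>y. y \<otimes> r) ` {x \<in> carrier G. x [^] p = \<one>}"
      proof
        fix x assume x: "x \<in> {x \<in> carrier G. x [^] p = c}"
        have "(x \<otimes> inv r) [^] p = \<one>"
          using x r nat_pow_closed[OF r(1), of p] by (auto simp: nat_pow_distrib nat_pow_inv)
        moreover have "x = (x \<otimes> inv r) \<otimes> r"
          using x r by (simp add: m_assoc)
        ultimately show "x \<in> (\<lambda>y. y \<otimes> r) ` {x \<in> carrier G. x [^] p = \<one>}"
          using x r by blast
      qed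
      then show ?thesis
        using prime[OF p(1)] finite_surj by blast
    next
      case False
      then have empty: "{x \<in> carrier G. x [^] p = c} = {}" by blast
      show ?thesis unfolding empty by simp
    qed
    have "{x \<in> carrier G. x [^] e = \<one>}
        \<subseteq> (\<Union>c\<in>{x \<in> carrier G. x [^] d = \<one>}. {x \<in> carrier G. x [^] p = c})"
      by (auto simp: d nat_pow_pow)
    then show ?thesis
      using fin fibre by (meson finite_UN finite_subset)
  qed
qed

text \<open>For a finite abelian group \<open>H\<close> the groups \<open>H / H\<^sup>e\<close> and
  \<open>{x \<in> H. x\<^sup>e = 1}\<close> have the same order. Applied to the finite subgroups of \<open>G\<close>, this bounds
  the number of pairwise inequivalent elements modulo \<open>e\<close>-th powers.\<close>

lemma card_le_card_torsion:
  assumes per: "periodic G" and fin: "finite {x \<in> carrier G. x [^] (e::nat) = \<one>}"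
    and S: "finite S" "S \<subseteq> carrier G"
    and ind: "\<And>s t x. \<lbrakk>s \<in> S; t \<in> S; x \<in> carrier G; s = t \<otimes> x [^] e\<rbrakk> \<Longrightarrow> s = t"
  shows "card S \<le> card {x \<in> carrier G. x [^] e = \<one>}"
proof -
  obtain H where H: "subgroup H G" "finite H" "S \<subseteq> H"
    using ex_finite_subgroup[OF per S] by blast
  let ?K = "{x \<in> carrier G. x [^] e = \<one>}" and ?I = "(\<lambda>x. x [^] e) ` H"
  have car: "\<And>x. x \<in> H \<Longrightarrow> x \<in> carrier G"
    using H(1) by (rule subgroup.mem_carrier)
  have powH: "\<And>x. x \<in> H \<Longrightarrow> x [^] e \<in> H"
    using subgroup_int_pow_closed[OF H(1), of _ "int e"] by (simp add: int_pow_int)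
  have "\<forall>i\<in>?I. \<exists>x. x \<in> H \<and> x [^] e = i" by blast
  then obtain r where r: "\<And>i. i \<in> ?I \<Longrightarrow> r i \<in> H \<and> r i [^] e = i"
    using bchoice by meson
  \<comment> \<open>Here \<open>r\<close> picks an \<open>e\<close>-th root in \<open>H\<close> of
    each power. Dividing \<open>x\<close> by the root of its own power leaves an
    \<open>e\<close>-torsion element, and the pair recovers \<open>x\<close>.\<close>
  have "card H \<le> card (?K \<times> ?I)"
  proof (rule card_inj_on_le)
    show "inj_on (\<lambda>x. (x \<otimes> inv (r (x [^] e)), x [^] e)) H"
      using r car by (intro inj_onI) (metis Pair_inject imageI inv_closed r_cancel)
    show "(\<lambda>x. (x \<otimes> inv (r (x [^] e)), x [^] e)) ` H \<subseteq> ?K \<times> ?I"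
      using r car by (auto simp: nat_pow_distrib nat_pow_inv)
    show "finite (?K \<times> ?I)"
      using fin H(2) by blast
  qed
  \<comment> \<open>The elements of \<open>S\<close> lie in distinct cosets of the group of
    \<open>e\<close>-th powers, so products with \<open>?I\<close> do not collide.\<close>
  moreover have "card (S \<times> ?I) \<le> card H"
  proof (rule card_inj_on_le)
    show "inj_on (\<lambda>(s, i). s \<otimes> i) (S \<times> ?I)"
    proof (rule inj_onI, clarify)
      fix s t x y
      assume st: "s \<in> S" "t \<in> S" "x \<in> H" "y \<in> H" and eq: "s \<otimes> x [^] e = t \<otimes> y [^] e"
      have c: "s \<in> carrier G" "t \<in> carrier G" "x \<in> carrier G" "y \<in> carrier G"
        using st S(2) car by auto
      have "s = (s \<otimes> x [^] e) \<otimes> inv (x [^] e)"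
        using c by (simp add: m_assoc)
      also have "\<dots> = t \<otimes> (y \<otimes> inv x) [^] e"
        using c by (simp add: eq nat_pow_distrib nat_pow_inv m_assoc)
      finally have "s = t"
        by (intro ind[OF st(1,2) m_closed[OF c(4) inv_closed[OF c(3)]]])
      then show "s = t \<and> x [^] e = y [^] e"
        using eq c by simp
    qed
    show "(\<lambda>(s, i). s \<otimes> i) ` (S \<times> ?I) \<subseteq> H"
      using H powH subgroup.m_closed[OF H(1)] by auto
    show "finite H" by (rule H(2))
  qed
  ultimately have "card (S \<times> ?I) \<le> card (?K \<times> ?I)"
    by (rule order_trans[rotated])
  then have "card S * card ?I \<le> card ?K * card ?I"
    unfolding card_cartesian_product .
  moreover have "0 < card ?I"
    using H(1,2) subgroup.one_closed by (auto simp: card_gt_0_iff)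
  ultimately show ?thesis
    by simp
qed

text \<open>Sets of elements pairwise incongruent modulo \<open>e\<close>-th powers are bounded in
  size by the \<open>e\<close>-torsion. One of greatest size represents every coset, since an
  element of a missed coset could be added.\<close>

lemma finite_representatives_mod_powers:
  assumes per: "periodic G" and fin: "finite {x \<in> carrier G. x [^] (e::nat) = \<one>}"
  shows "\<exists>Y. finite Y \<and> Y \<subseteq> carrier G \<and>
    (\<forall>m\<in>carrier G. \<exists>y\<in>Y. \<exists>x\<in>carrier G. m = y \<otimes> x [^] e)"
proof -
  define P where "P S \<longleftrightarrow> finite S \<and> S \<subseteq> carrier G \<and>
    (\<forall>s\<in>S. \<forall>t\<in>S. (\<exists>x\<in>carrier G. s = t \<otimes> x [^] e) \<longrightarrow> s = t)" for S
  have "P {}" by (simp add: P_def)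
  moreover have "\<forall>S. P S \<longrightarrow> card S < Suc (card {x \<in> carrier G. x [^] e = \<one>})"
    using card_le_card_torsion[OF per fin] unfolding P_def by (meson le_imp_less_Suc)
  ultimately obtain Y where Y: "P Y" and max: "\<And>S. P S \<Longrightarrow> card S \<le> card Y"
    using ex_has_greatest_nat[of P "{}" card] by blast
  have Yc: "finite Y" "Y \<subseteq> carrier G"
    using Y by (auto simp: P_def)
  have "\<exists>y\<in>Y. \<exists>x\<in>carrier G. m = y \<otimes> x [^] e" if m: "m \<in> carrier G" for m
  proof (rule ccontr)
    assume no: "\<not> ?thesis"
    have "m \<notin> Y"
      using no m by (metis nat_pow_one one_closed r_one)
    \<comment> \<open>Congruence modulo \<open>e\<close>-th powers is symmetric, with
      \<open>inv x\<close> as the witness.\<close>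
    have no': "t \<noteq> m \<otimes> x [^] e" if "t \<in> Y" "x \<in> carrier G" for t x
    proof
      assume t: "t = m \<otimes> x [^] e"
      have "m = t \<otimes> inv x [^] e"
        using m that by (simp add: t m_assoc nat_pow_inv)
      then show False
        using no that by blast
    qed
    have "P (insert m Y)"
      unfolding P_def
    proof (intro conjI ballI impI)
      show "finite (insert m Y)" "insert m Y \<subseteq> carrier G"
        using Yc m by auto
      fix s t assume "s \<in> insert m Y" "t \<in> insert m Y" "\<exists>x\<in>carrier G. s = t \<otimes> x [^] e"
      moreover have "s = t" if "s \<in> Y" "t \<in> Y" "\<exists>x\<in>carrier G. s = t \<otimes> x [^] e" for s t
        using Y that unfolding P_def by simp
      ultimately show "s = t"
        using no no' by (metis insertE)
    qed
    then show False
      using max \<open>m \<notin> Y\<close> Yc(1) by fastforce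
  qed
  then show ?thesis
    using Yc by blast
qed

section \<open>A subgroup maximal among those meeting \<open>F\<close> trivially, and its
  quotient\<close>

lemma ex_maximal_subgroup_disjoint:
  assumes F: "subgroup F G"
  obtains B where "subgroup B G" and "B \<inter> F = {\<one>}"
    and "\<And>C. \<lbrakk>subgroup C G; C \<inter> F = {\<one>}; B \<subseteq> C\<rbrakk> \<Longrightarrow> C = B"
proof -
  let ?\<A> = "{B. subgroup B G \<and> B \<inter> F = {\<one>}}"
  have "\<exists>M\<in>?\<A>. \<forall>H\<in>?\<A>. M \<subseteq> H \<longrightarrow> H = M"
  proof (rule subset_Zorn_nonempty)
    have "{\<one>} \<in> ?\<A>"
      using triv_subgroup subgroup.one_closed[OF F] by auto
    then show "?\<A> \<noteq> {}" by blast
    fix \<C> assume ne: "\<C> \<noteq> {}" and ch: "subset.chain ?\<A> \<C>"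
    have C: "\<And>B. B \<in> \<C> \<Longrightarrow> subgroup B G \<and> B \<inter> F = {\<one>}"
      using ch by (auto simp: subset_chain_def)
    have "subgroup (\<Union>\<C>) G"
    proof (rule subgroup.intro)
      show "\<Union>\<C> \<subseteq> carrier G" "\<one> \<in> \<Union>\<C>"
        using C ne by (auto dest: subgroup.subset subgroup.one_closed)
      show "inv x \<in> \<Union>\<C>" if "x \<in> \<Union>\<C>" for x
        using C that by (auto intro: subgroup.m_inv_closed)
      fix x y assume "x \<in> \<Union>\<C>" "y \<in> \<Union>\<C>"
      then obtain U V where UV: "U \<in> \<C>" "V \<in> \<C>" "x \<in> U" "y \<in> V" by blast
      then have "U \<subseteq> V \<or> V \<subseteq> U"
        using ch unfolding subset_chain_def by blast
      then obtain W where "W \<in> \<C>" "x \<in> W" "y \<in> W"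
        using UV by blast
      then show "x \<otimes> y \<in> \<Union>\<C>"
        using C by (auto intro: subgroup.m_closed)
    qed
    moreover have "\<Union>\<C> \<inter> F = {\<one>}"
      using C ne by blast
    ultimately show "\<Union>\<C> \<in> ?\<A>" by blast
  qed
  then show thesis
    using that by auto
qed

text \<open>Maximality of \<open>B\<close> makes \<open>G / B\<close> an essential extension of the image of \<open>F\<close>,
  which therefore contains all elements of prime order.\<close>

lemma mem_set_mult_if_prime_power_mem:
  assumes F: "subgroup F G" and B: "subgroup B G" and disj: "B \<inter> F = {\<one>}"
    and max: "\<And>C. \<lbrakk>subgroup C G; C \<inter> F = {\<one>}; B \<subseteq> C\<rbrakk> \<Longrightarrow> C = B"
    and x: "x \<in> carrier G" and p: "Factorial_Ring.prime (p::nat)" and xp: "x [^] p \<in> B"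
  shows "x \<in> B <#> F"
proof (cases "x \<in> B")
  case True
  then show ?thesis
    using mem_set_multI[OF True subgroup.one_closed[OF F], of G] x by simp
next
  case False
  let ?C = "carrier (subgroup_generated G {x})"
  have C: "subgroup ?C G"
    by (rule subgroup_subgroup_generated)
  have C_eq: "?C = range (\<lambda>k::int. x [^] k)"
    using x by (rule carrier_subgroup_generated_by_singleton)
  have Bpow: "b [^] (k::int) \<in> B" if "b \<in> B" for b k
    using B that by (rule subgroup_int_pow_closed)
  have Fpow: "f [^] (k::int) \<in> F" if "f \<in> F" for f k
    using F that by (rule subgroup_int_pow_closed)
  note Bc = subgroup.mem_carrier[OF B] and Fc = subgroup.mem_carrier[OF F]
  have "x [^] (1::int) \<in> ?C"
    unfolding C_eq by (rule rangeI)
  then have "x \<in> B <#> ?C"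
    using mem_set_multI[of "\<one>" B x ?C G] subgroup.one_closed[OF B] x by simp
  moreover have "B \<subseteq> B <#> ?C"
  proof
    fix b assume "b \<in> B"
    then show "b \<in> B <#> ?C"
      using mem_set_multI[of b B "\<one>" ?C G] subgroup.one_closed[OF C] Bc by simp
  qed
  moreover have "subgroup (B <#> ?C) G"
    using B C by (rule mult_subgroups)
  \<comment> \<open>Adjoining \<open>x\<close> enlarges \<open>B\<close> properly, so by maximality
    the result meets \<open>F\<close> in some \<open>f\<close> other than
    \<open>\<one>\<close>.\<close>
  ultimately have "(B <#> ?C) \<inter> F \<noteq> {\<one>}"
    using max False by blast
  moreover have "\<one> \<in> (B <#> ?C) \<inter> F"
    using \<open>subgroup (B <#> ?C) G\<close> F subgroup.one_closed by blast
  ultimately obtain f where f: "f \<in> F" "f \<noteq> \<one>" "f \<in> B <#> ?C" by blast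
  then obtain b and k :: int where b: "b \<in> B" and fbk: "f = b \<otimes> x [^] k"
    unfolding set_mult_def C_eq by blast
  have xpi: "x [^] (int p * j) \<in> B" for j
    using Bpow[OF xp, of j] x by (simp add: int_pow_pow flip: int_pow_int)
  \<comment> \<open>Otherwise \<open>f\<close> would lie in both \<open>B\<close> and
    \<open>F\<close>.\<close>
  have "\<not> int p dvd k"
  proof
    assume "int p dvd k"
    then have "x [^] k \<in> B"
      using xpi by blast
    then have "f \<in> B"
      using subgroup.m_closed[OF B b] by (simp add: fbk)
    then show False
      using f disj by blast
  qed
  then have "coprime (int p) k"
    using p by (simp add: prime_imp_coprime)
  moreover obtain u v where "u * int p + v * k = gcd (int p) k"
    using bezout_int by blast
  ultimately have uv: "int p * u + k * v = 1"
    by (simp add: mult.commute)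
  have xk: "x [^] k = inv b \<otimes> f"
    using b f x Bc by (simp add: fbk flip: m_assoc)
  \<comment> \<open>The Bezout identity splits \<open>x\<close> into a power of
    \<open>x [^] p\<close>, which is in \<open>B\<close>, and a power of \<open>x [^] k\<close>,
    which is in \<open>B <#> F\<close>.\<close>
  have "x = x [^] (int p * u + k * v)"
    using x by (simp only: uv int_pow_1)
  also have "\<dots> = x [^] (int p * u) \<otimes> (x [^] k) [^] v"
    using x by (simp add: int_pow_mult int_pow_pow)
  also have "\<dots> = (x [^] (int p * u) \<otimes> inv b [^] v) \<otimes> f [^] v"
    using x b f Bc Fc by (simp add: xk int_pow_distrib m_assoc)
  finally have "x = (x [^] (int p * u) \<otimes> inv b [^] v) \<otimes> f [^] v" .
  moreover have "x [^] (int p * u) \<otimes> inv b [^] v \<in> B"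
    using b by (intro subgroup.m_closed[OF B] xpi Bpow subgroup.m_inv_closed[OF B])
  ultimately show ?thesis
    using mem_set_multI Fpow[OF f(1)] by metis
qed

text \<open>In \<open>G Mod B\<close> the elements of prime order come from the finite group
  \<open>F\<close>, so the \<open>e\<close>-torsion is finite and finitely many cosets represent
  everything modulo \<open>e\<close>-th powers; \<open>Y\<close> lifts these cosets. An automorphism
  is thus determined by its values on \<open>B\<close>, on \<open>Y\<close> and on the
  \<open>e\<close>-th powers.\<close>

lemma ex_almost_complement:
  assumes per: "periodic G" and F: "subgroup F G" and "finite F" and "0 < (e::nat)"
  obtains B Y where "subgroup B G" and "B \<inter> F = {\<one>}" and "finite Y" and "Y \<subseteq> carrier G"
    and "\<And>a. a \<in> carrier G \<Longrightarrow> \<exists>b\<in>B. \<exists>y\<in>Y. \<exists>x\<in>carrier G. a = b \<otimes> (y \<otimes> x [^] e)"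
proof -
  obtain B where B: "subgroup B G" and disj: "B \<inter> F = {\<one>}"
    and max: "\<And>C. \<lbrakk>subgroup C G; C \<inter> F = {\<one>}; B \<subseteq> C\<rbrakk> \<Longrightarrow> C = B"
    using ex_maximal_subgroup_disjoint[OF F] by metis
  interpret N: normal B G
    using B by (simp add: normal_iff_subgroup)
  interpret M: comm_group "G Mod B"
    using B by (rule abelian_FactGroup)
  have carM: "\<exists>x\<in>carrier G. m = B #> x" if "m \<in> carrier (G Mod B)" for m
    using that by (auto simp: carrier_FactGroup)
  have perM: "periodic (G Mod B)"
    unfolding periodic_def
  proof
    fix m assume "m \<in> carrier (G Mod B)"
    then obtain x where x: "x \<in> carrier G" "m = B #> x"
      using carM by blast
    obtain n :: nat where "0 < n" "x [^] n = \<one>"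
      using per x unfolding periodic_def by blast
    then show "\<exists>n::nat. 0 < n \<and> m [^]\<^bsub>G Mod B\<^esub> n = \<one>\<^bsub>G Mod B\<^esub>"
      using x N.subset by (intro exI[of _ n]) (simp add: N.FactGroup_pow)
  qed
  have "finite {m \<in> carrier (G Mod B). m [^]\<^bsub>G Mod B\<^esub> p = \<one>\<^bsub>G Mod B\<^esub>}" if p: "Factorial_Ring.prime p" for p :: nat
  proof (rule finite_subset)
    show "{m \<in> carrier (G Mod B). m [^]\<^bsub>G Mod B\<^esub> p = \<one>\<^bsub>G Mod B\<^esub>} \<subseteq> (\<lambda>f. B #> f) ` F"
    proof
      fix m assume "m \<in> {m \<in> carrier (G Mod B). m [^]\<^bsub>G Mod B\<^esub> p = \<one>\<^bsub>G Mod B\<^esub>}"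
      then obtain x where x: "x \<in> carrier G" "m = B #> x" and "B #> x [^] p = B"
        using carM N.FactGroup_pow by force
      then have "x [^] p \<in> B"
        using rcos_self[OF nat_pow_closed[OF x(1), of p] B] by simp
      then obtain b f where "b \<in> B" "f \<in> F" "x = b \<otimes> f"
        using mem_set_mult_if_prime_power_mem[OF F B disj max x(1) p] unfolding set_mult_def
        by blast
      then have "m = B #> f"
        using x B F by (metis coset_join2 coset_mult_assoc subgroup.mem_carrier subgroup.subset)
      then show "m \<in> (\<lambda>f. B #> f) ` F"
        using \<open>f \<in> F\<close> by blast
    qed
    show "finite ((\<lambda>f. B #> f) ` F)"
      using \<open>finite F\<close> by blast
  qed
  then have finM: "finite {m \<in> carrier (G Mod B). m [^]\<^bsub>G Mod B\<^esub> e = \<one>\<^bsub>G Mod B\<^esub>}"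
    using \<open>0 < e\<close> by (rule M.finite_torsion)
  obtain Z where Z: "finite Z" "Z \<subseteq> carrier (G Mod B)"
    and rep: "\<And>m. m \<in> carrier (G Mod B) \<Longrightarrow>
      \<exists>z\<in>Z. \<exists>x\<in>carrier (G Mod B). m = z \<otimes>\<^bsub>G Mod B\<^esub> x [^]\<^bsub>G Mod B\<^esub> e"
    using M.finite_representatives_mod_powers[OF perM finM] by (elim exE conjE) auto
  have "\<forall>m\<in>carrier (G Mod B). \<exists>x. x \<in> carrier G \<and> m = B #> x"
    using carM by blast
  then obtain r where r: "\<And>m. m \<in> carrier (G Mod B) \<Longrightarrow> r m \<in> carrier G \<and> m = B #> r m"
    using bchoice by meson
  show thesis
  proof (rule that[OF B disj])
    show "finite (r ` Z)" "r ` Z \<subseteq> carrier G"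
      using Z r by blast+
    fix a assume a: "a \<in> carrier G"
    have "B #> a \<in> carrier (G Mod B)"
      using a by (auto simp: carrier_FactGroup)
    then obtain z m where z: "z \<in> Z" and m: "m \<in> carrier (G Mod B)"
      and eq: "B #> a = z \<otimes>\<^bsub>G Mod B\<^esub> m [^]\<^bsub>G Mod B\<^esub> e"
      using rep by blast
    have rz: "r z \<in> carrier G" "z = B #> r z" and rm: "r m \<in> carrier G" "m = B #> r m"
      using r z m Z(2) by blast+
    have "B #> a = (B #> r z) \<otimes>\<^bsub>G Mod B\<^esub> (B #> r m) [^]\<^bsub>G Mod B\<^esub> e"
      using eq rz rm by simp
    also have "\<dots> = B #> (r z \<otimes> r m [^] e)"
      using rz(1) rm(1) by (simp add: N.FactGroup_pow N.rcos_sum)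
    \<comment> \<open>Elements of the same coset differ by an element of \<open>B\<close>, which
      supplies \<open>b\<close>.\<close>
    finally have "a \<in> B #> (r z \<otimes> r m [^] e)"
      using rcos_self[OF a B] by simp
    then show "\<exists>b\<in>B. \<exists>y\<in>r ` Z. \<exists>x\<in>carrier G. a = b \<otimes> (y \<otimes> x [^] e)"
      using z rm(1) unfolding r_coset_def by blast
  qed
qed

end

section \<open>Automorphisms with a common displacement subgroup, counted by their images of
  \<open>B\<close>\<close>

theorem theorem3p2:
  fixes A :: "('a, 'b) monoid_scheme" and \<Phi> :: "('a \<Rightarrow> 'a) set"
  assumes "comm_group A" and "countable (carrier A)" and "periodic A"
    and "subgroup \<Phi> (AutoGroup A)" and "\<forall>\<phi>\<in>\<Phi>. fc_automorphism A \<phi>"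
    and "natLeq <o cofinality |\<Phi>|"
  shows "\<exists>B. subgroup B A \<and> |{\<phi> ` B | \<phi>. \<phi> \<in> \<Phi>}| =o |\<Phi>|"
proof -
  interpret comm_group A by fact
  let ?D = "\<lambda>\<phi>. {g \<otimes>\<^bsub>A\<^esub> \<phi> (inv\<^bsub>A\<^esub> g) | g. g \<in> carrier A}"
  have hom: "\<And>\<phi>. \<phi> \<in> \<Phi> \<Longrightarrow> \<phi> \<in> hom A A"
    and ext: "\<And>\<phi>. \<phi> \<in> \<Phi> \<Longrightarrow> \<phi> \<in> extensional (carrier A)"
    and fin: "\<And>\<phi>. \<phi> \<in> \<Phi> \<Longrightarrow> finite (?D \<phi>)"
    using assms(5) by (auto simp: fc_automorphism_def auto_def Bij_def)
  have gh: "group_hom A A \<phi>" if "\<phi> \<in> \<Phi>" for \<phi>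
    using hom[OF that] by (simp add: group_hom_def group_hom_axioms_def is_group)
  have clo: "\<phi> g \<in> carrier A" if "\<phi> \<in> \<Phi>" "g \<in> carrier A" for \<phi> g
    using hom[OF that(1)] that(2) by (rule hom_in_carrier)
  \<comment> \<open>A countable set has only countably many finite subsets, so the pigeonhole
    principle applies to \<open>\<phi> \<mapsto> ?D \<phi>\<close>.\<close>
  have "?D ` \<Phi> \<subseteq> Fpow (carrier A)"
    using fin clo by (auto simp: Fpow_def)
  then have "countable (?D ` \<Phi>)"
    using assms(2) countable_Fpow countable_subset by blast
  then obtain F where "F \<in> ?D ` \<Phi>" and card\<Psi>: "|{\<phi> \<in> \<Phi>. ?D \<phi> = F}| =o |\<Phi>|"
    by (rule pigeonhole_natLeq_less_cofinality[OF assms(6)])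
  then obtain \<phi>0 where \<phi>0: "\<phi>0 \<in> \<Phi>" and F_eq: "F = ?D \<phi>0" by blast
  define \<Psi> where "\<Psi> = {\<phi> \<in> \<Phi>. ?D \<phi> = F}"
  have finF: "finite F"
    using F_eq fin[OF \<phi>0] by simp
  have F: "subgroup F A"
  proof -
    \<comment> \<open>As \<open>A\<close> is abelian, the displacement map is an endomorphism, and
      \<open>F\<close> is its image.\<close>
    have "(\<lambda>g. g \<otimes>\<^bsub>A\<^esub> \<phi>0 (inv\<^bsub>A\<^esub> g)) \<in> hom A A"
      using clo[OF \<phi>0] hom_mult[OF hom[OF \<phi>0]] by (intro homI) (auto simp: inv_mult m_ac)
    then have "subgroup ((\<lambda>g. g \<otimes>\<^bsub>A\<^esub> \<phi>0 (inv\<^bsub>A\<^esub> g)) ` carrier A) A"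
      by (intro group_hom.img_is_subgroup) (simp add: group_hom_def group_hom_axioms_def is_group)
    then show ?thesis
      by (simp add: F_eq Setcompr_eq_image)
  qed
  define e where "e = card F"
  have "0 < e"
    using finF subgroup.one_closed[OF F] by (auto simp: e_def card_gt_0_iff)
  have Fe: "f [^]\<^bsub>A\<^esub> e = \<one>\<^bsub>A\<^esub>" if "f \<in> F" for f
    using group.pow_order_eq_1[OF subgroup_imp_group[OF F], of f] that
    by (simp add: e_def order_def flip: nat_pow_consistent)
  obtain B Y where B: "subgroup B A" and disj: "B \<inter> F = {\<one>\<^bsub>A\<^esub>}"
    and Y: "finite Y" "Y \<subseteq> carrier A"
    and rep: "\<And>a. a \<in> carrier A \<Longrightarrow>
      \<exists>b\<in>B. \<exists>y\<in>Y. \<exists>x\<in>carrier A. a = b \<otimes>\<^bsub>A\<^esub> (y \<otimes>\<^bsub>A\<^esub> x [^]\<^bsub>A\<^esub> e)"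
    using ex_almost_complement[OF assms(3) F finF \<open>0 < e\<close>] by metis
  have shift: "\<exists>f\<in>F. \<phi> g = g \<otimes>\<^bsub>A\<^esub> f" if "\<phi> \<in> \<Psi>" "g \<in> carrier A" for \<phi> g
  proof -
    have \<phi>: "\<phi> \<in> \<Phi>" "?D \<phi> = F"
      using that by (auto simp: \<Psi>_def)
    \<comment> \<open>This is the displacement of the inverse of \<open>g\<close>.\<close>
    have "inv\<^bsub>A\<^esub> g \<otimes>\<^bsub>A\<^esub> \<phi> (inv\<^bsub>A\<^esub> (inv\<^bsub>A\<^esub> g)) \<in> F"
      using \<phi>(2) that(2) inv_closed by blast
    then have "inv\<^bsub>A\<^esub> g \<otimes>\<^bsub>A\<^esub> \<phi> g \<in> F"
      using that(2) by simp
    moreover have "\<phi> g = g \<otimes>\<^bsub>A\<^esub> (inv\<^bsub>A\<^esub> g \<otimes>\<^bsub>A\<^esub> \<phi> g)"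
      using clo[OF \<phi>(1)] that(2) by (simp flip: m_assoc)
    ultimately show ?thesis by blast
  qed
  have pow: "\<phi> (x [^]\<^bsub>A\<^esub> e) = x [^]\<^bsub>A\<^esub> e" if "\<phi> \<in> \<Psi>" "x \<in> carrier A" for \<phi> x
  proof -
    have "\<phi> \<in> \<Phi>"
      using that by (simp add: \<Psi>_def)
    from shift[OF that] obtain f where f: "f \<in> F" "\<phi> x = x \<otimes>\<^bsub>A\<^esub> f"
      by blast
    have "\<phi> (x [^]\<^bsub>A\<^esub> e) = (x \<otimes>\<^bsub>A\<^esub> f) [^]\<^bsub>A\<^esub> e"
      using group_hom.hom_nat_pow[OF gh[OF \<open>\<phi> \<in> \<Phi>\<close>] that(2)] f(2) by simp
    also have "\<dots> = x [^]\<^bsub>A\<^esub> e"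
      using that(2) f(1) Fe subgroup.mem_carrier[OF F] by (simp add: nat_pow_distrib)
    finally show ?thesis .
  qed
  let ?O = "{\<phi> ` B | \<phi>. \<phi> \<in> \<Phi>}"
  \<comment> \<open>The restriction to \<open>Y\<close> is recorded by its graph, a finite subset of
    a countable set, so the second component takes countably many values.\<close>
  let ?h = "\<lambda>\<phi>. (\<phi> ` B, (\<lambda>y. (y, \<phi> y)) ` Y)"
  have "inj_on ?h \<Psi>"
  proof (rule inj_onI)
    fix \<phi> \<psi> assume \<phi>: "\<phi> \<in> \<Psi>" and \<psi>: "\<psi> \<in> \<Psi>" and h: "?h \<phi> = ?h \<psi>"
    have \<Phi>: "\<phi> \<in> \<Phi>" "\<psi> \<in> \<Phi>"
      using \<phi> \<psi> by (auto simp: \<Psi>_def)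
    have onY: "\<phi> y = \<psi> y" if "y \<in> Y" for y
      using h that by auto
    have onB: "\<phi> b = \<psi> b" if b: "b \<in> B" for b
    proof -
      obtain b' where b': "b' \<in> B" "\<phi> b = \<psi> b'"
        using h b by blast
      have c: "b \<in> carrier A" "b' \<in> carrier A"
        using b b' B subgroup.mem_carrier by metis+
      obtain f f' where f: "f \<in> F" "\<phi> b = b \<otimes>\<^bsub>A\<^esub> f" and f': "f' \<in> F" "\<psi> b' = b' \<otimes>\<^bsub>A\<^esub> f'"
        using shift \<phi> \<psi> c by metis
      have fc: "f \<in> carrier A" "f' \<in> carrier A"
        using f f' F subgroup.mem_carrier by metis+
      \<comment> \<open>The quotient of \<open>b\<close> by \<open>b'\<close> lies in
        \<open>B\<close> and equals a quotient of elements of \<open>F\<close>, so it is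
        trivial.\<close>
      have "b \<otimes>\<^bsub>A\<^esub> f = b' \<otimes>\<^bsub>A\<^esub> f'"
        using f f' b' by simp
      then have "inv\<^bsub>A\<^esub> b' \<otimes>\<^bsub>A\<^esub> b = f' \<otimes>\<^bsub>A\<^esub> inv\<^bsub>A\<^esub> f"
        using c fc by (metis inv_closed inv_solve_left inv_solve_right m_assoc m_closed)
      moreover have "inv\<^bsub>A\<^esub> b' \<otimes>\<^bsub>A\<^esub> b \<in> B"
        using B b b' subgroup.m_closed subgroup.m_inv_closed by metis
      moreover have "f' \<otimes>\<^bsub>A\<^esub> inv\<^bsub>A\<^esub> f \<in> F"
        using F f f' subgroup.m_closed subgroup.m_inv_closed by metis
      ultimately have "inv\<^bsub>A\<^esub> b' \<otimes>\<^bsub>A\<^esub> b = \<one>\<^bsub>A\<^esub>"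
        using disj by auto
      then have "b = b'"
        using c by (metis inv_closed inv_equality inv_inv)
      then show ?thesis
        using b' by simp
    qed
    show "\<phi> = \<psi>"
    proof (rule extensionalityI[OF ext[OF \<Phi>(1)] ext[OF \<Phi>(2)]])
      fix a assume "a \<in> carrier A"
      \<comment> \<open>Both automorphisms agree on \<open>b\<close> and on \<open>y\<close>, and
        both fix the \<open>e\<close>-th power of \<open>x\<close>.\<close>
      then obtain b y x where b: "b \<in> B" and y: "y \<in> Y" and x: "x \<in> carrier A"
        and a: "a = b \<otimes>\<^bsub>A\<^esub> (y \<otimes>\<^bsub>A\<^esub> x [^]\<^bsub>A\<^esub> e)"
        using rep by blast
      have "b \<in> carrier A" "y \<in> carrier A"
        using b y Y(2) subgroup.mem_carrier[OF B] by auto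
      then show "\<phi> a = \<psi> a"
        using hom_mult[OF hom[OF \<Phi>(1)]] hom_mult[OF hom[OF \<Phi>(2)]] x
        by (simp add: a onB[OF b] onY[OF y] pow[OF \<phi> x] pow[OF \<psi> x])
    qed
  qed
  moreover have "?h ` \<Psi> \<subseteq> ?O \<times> Fpow (carrier A \<times> carrier A)"
    using Y clo by (auto simp: \<Psi>_def Fpow_def)
  ultimately have "|\<Psi>| \<le>o |?O \<times> Fpow (carrier A \<times> carrier A)|"
    using card_of_ordLeq by blast
  then have "|\<Phi>| \<le>o |?O \<times> Fpow (carrier A \<times> carrier A)|"
    using card\<Psi> ordIso_symmetric ordIso_ordLeq_trans unfolding \<Psi>_def by blast
  moreover have "countable (Fpow (carrier A \<times> carrier A))"
    using assms(2) by (intro countable_Fpow countable_SIGMA)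
  ultimately have "|\<Phi>| \<le>o |?O|"
    using uncountable_if_natLeq_less_cofinality[OF assms(6)]
    by (intro card_of_ordLeq_if_ordLeq_Times_countable[of \<Phi> "Fpow (carrier A \<times> carrier A)" ?O])
  moreover have "|?O| \<le>o |\<Phi>|"
    using card_of_image[of "\<lambda>\<phi>. \<phi> ` B" \<Phi>] by (simp add: Setcompr_eq_image)
  ultimately show ?thesis
    using B ordIso_iff_ordLeq by blast
qed

end
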